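(* Let $P$ be an SD program with Herbrand base of size $n$, let $\bm{M}_P\in\mathbb{R}^{n\times n}$ be its program matrix and $\bm{v}_0\in\mathbb{R}^n$ its initial vector. Define $\Gamma_P^1=(\bm{M}_P)^2$ and $\Gamma_P^{k+1}=(\Gamma_P^k)^2$ for $k\ge 1$, and define $\bm{v}_k=\theta(\bm{M}_P\bm{v}_{k-1})$ for $k\ge 1$. Then for every $k\ge 1$, $$\theta(\Gamma_P^k\,\bm{v}_0)=\bm{v}_{2^k}.$$
   Context: A definite program $P$ is a finite set of rules $h\leftarrow b_1\wedge\cdots\wedge b_m$ ($m\ge 0$), where $h$ and the $b_i$ are propositional variables and the $b_i$ are pairwise distinct; $h$ is the head of the rule. A rule with empty body is a fact, written $h\leftarrow$. The Herbrand base $B_P=\{p_1,\ldots,p_n\}$ is the set of all propositional variables appearing in $P$. $P$ is an SD (singly defined) program if any two distinct rules of $P$ have distinct heads. The initial vector $\bm{v}_0=(a_1,\ldots,a_n)^{\mathsf T}$ of $P$ has $a_i=1$ if the fact $p_i\leftarrow$ is in $P$, and $a_i=0$ otherwise. The program matrix $\bm{M}_P=(a_{ij})\in\mathbb{R}^{n\times n}$ of an SD program is given by: (1) if $p_i\leftarrow p_{j_1}\wedge\cdots\wedge p_{j_m}$ with $m\ge 1$ is in $P$, then $a_{ij_k}=\frac1m$ for $1\le k\le m$; (2) if the fact $p_i\leftarrow$ is in $P$, then $a_{ii}=1$; (3) all other entries are $0$. For $\bm{v}=(a_1,\ldots,a_n)^{\mathsf T}$, $\theta(\bm{v})=(a_1',\ldots,a_n')^{\mathsf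 T}$ where $a_i'=1$ if $a_i\ge 1$ and $a_i'=0$ otherwise. The superscript in $\Gamma_P^k$ is an index, not a power. *)

theory Defs
  imports Complex_Main "Jordan_Normal_Form.Matrix"
begin

text \<open>\<open>Rule h [b1, \<dots>, bm]\<close> is the rule \<open>h \<leftarrow> b1 \<and> \<dots> \<and> bm\<close>; \<open>Rule h []\<close> is the fact \<open>h \<leftarrow>\<close>.\<close>

datatype 'a rule = Rule (head: 'a) (body: "'a list")

definition definite_program :: "'a rule set \<Rightarrow> bool" where
  "definite_program P \<longleftrightarrow> finite P \<and> (\<forall>r\<in>P. distinct (body r))"

definition herbrand_base :: "'a rule set \<Rightarrow> 'a set" where
  "herbrand_base P = (\<Union>r\<in>P. insert (head r) (set (body r)))"

definition sd_program :: "'a rule set \<Rightarrow> bool" where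
  "sd_program P \<longleftrightarrow>
     definite_program P \<and> (\<forall>r\<in>P. \<forall>s\<in>P. r \<noteq> s \<longrightarrow> head r \<noteq> head s)"

text \<open>Vectors and matrices are relative to an enumeration \<open>p 0, \<dots>, p (n - 1)\<close> of the
  Herbrand base; indices start at 0.\<close>

definition initial_vec :: "'a rule set \<Rightarrow> nat \<Rightarrow> (nat \<Rightarrow> 'a) \<Rightarrow> real vec" where
  "initial_vec P n p = vec n (\<lambda>i. if Rule (p i) [] \<in> P then 1 else 0)"

text \<open>The definite description is unambiguous for SD programs, which have at most one rule
  with head \<open>p i\<close>.\<close>

definition program_matrix :: "'a rule set \<Rightarrow> nat \<Rightarrow> (nat \<Rightarrow> 'a) \<Rightarrow> real mat" where
  "program_matrix P n p = mat n n (\<lambda>(i, j).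
     if \<exists>b. Rule (p i) b \<in> P \<and> p j \<in> set b
       then 1 / real (length (THE b. Rule (p i) b \<in> P))
     else if Rule (p i) [] \<in> P \<and> i = j then 1
     else 0)"

definition \<theta> :: "real vec \<Rightarrow> real vec" where
  "\<theta> v = map_vec (\<lambda>a. if a \<ge> 1 then 1 else 0) v"

text \<open>The sequence \<open>\<Gamma>\<close> is meant for indices \<open>k \<ge> 1\<close>; the value at 0 is chosen
  so that \<open>\<Gamma> 1\<close> is the square of the program matrix.\<close>

primrec Gamma :: "'a rule set \<Rightarrow> nat \<Rightarrow> (nat \<Rightarrow> 'a) \<Rightarrow> nat \<Rightarrow> real mat" where
  "Gamma P n p 0 = program_matrix P n p"
| "Gamma P n p (Suc k) = Gamma P n p k ^\<^sub>m 2"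

lemma Gamma_1: "Gamma P n p 1 = program_matrix P n p ^\<^sub>m 2"
  by simp

primrec v_seq :: "'a rule set \<Rightarrow> nat \<Rightarrow> (nat \<Rightarrow> 'a) \<Rightarrow> nat \<Rightarrow> real vec" where
  "v_seq P n p 0 = initial_vec P n p"
| "v_seq P n p (Suc k) = \<theta> (program_matrix P n p *\<^sub>v v_seq P n p k)"

end

theory Submission
  imports Defs
begin

text \<open>For a substochastic matrix \<open>M\<close> and a vector \<open>u\<close> with entries in \<open>[0, 1]\<close>, an entry of
  \<open>M u\<close> can reach 1 only if the corresponding row sums to 1 and is supported where \<open>u\<close> is 1.
  Hence \<open>\<theta> (M u) = \<theta> (M (\<theta> u))\<close>, so the intermediate thresholds in the sequence \<open>v\<close> can be
  dropped: \<open>v\<^sub>m = \<theta> (M^m v\<^sub>0)\<close>. The program matrix of an SD program is substochastic, and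
  \<open>\<Gamma>\<^sup>k\<close> is its power with exponent \<open>2^k\<close>.\<close>

definition substochastic :: "nat \<Rightarrow> real mat \<Rightarrow> bool" where
  "substochastic n M \<longleftrightarrow> M \<in> carrier_mat n n \<and> (\<forall>i<n. \<forall>j<n. 0 \<le> M $$ (i, j)) \<and>
     (\<forall>i<n. (\<Sum>j<n. M $$ (i, j)) \<le> 1)"

definition unit_vecs :: "nat \<Rightarrow> real vec set" where
  "unit_vecs n = {u \<in> carrier_vec n. \<forall>i<n. 0 \<le> u $ i \<and> u $ i \<le> 1}"

lemma mult_mat_vec_index:
  assumes "M \<in> carrier_mat n n" "u \<in> carrier_vec n" "i < n"
  shows "(M *\<^sub>v u) $ i = (\<Sum>j<n. M $$ (i, j) * u $ j)"
  using assms by (auto simp: scalar_prod_def atLeast0LessThan intro!: sum.cong)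

text \<open>Invariance of the cube [0, 1]^n keeps \<open>theta_mult_theta\<close> applicable to
  every iterate of the initial vector under \<open>M\<close>.\<close>

lemma substochastic_mult_unit_vecs:
  assumes M: "substochastic n M" and u: "u \<in> unit_vecs n"
  shows "M *\<^sub>v u \<in> unit_vecs n"
proof -
  have car: "M \<in> carrier_mat n n" "u \<in> carrier_vec n"
    using M u by (auto simp: substochastic_def unit_vecs_def)
  have "0 \<le> (M *\<^sub>v u) $ i \<and> (M *\<^sub>v u) $ i \<le> 1" if i: "i < n" for i
  proof -
    have "(\<Sum>j<n. M $$ (i, j) * u $ j) \<le> (\<Sum>j<n. M $$ (i, j))"
      using M u i by (intro sum_mono) (auto simp: substochastic_def unit_vecs_def mult_left_le)
    also have "\<dots> \<le> 1"
      using M i by (auto simp: substochastic_def)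
    finally have "(\<Sum>j<n. M $$ (i, j) * u $ j) \<le> 1" .
    moreover have "0 \<le> (\<Sum>j<n. M $$ (i, j) * u $ j)"
      using M u i by (intro sum_nonneg) (auto simp: substochastic_def unit_vecs_def)
    ultimately show ?thesis
      using mult_mat_vec_index[OF car i] by simp
  qed
  then show ?thesis
    using car by (auto simp: unit_vecs_def)
qed

lemma theta_carrier: "u \<in> carrier_vec n \<Longrightarrow> \<theta> u \<in> carrier_vec n"
  by (simp add: \<theta>_def)

lemma theta_index: "u \<in> carrier_vec n \<Longrightarrow> i < n \<Longrightarrow> \<theta> u $ i = (if u $ i \<ge> 1 then 1 else 0)"
  by (simp add: \<theta>_def)

lemma theta_mult_theta:
  assumes M: "substochastic n M" and u: "u \<in> unit_vecs n"
  shows "\<theta> (M *\<^sub>v \<theta> u) = \<theta> (M *\<^sub>v u)"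
proof -
  have car: "M \<in> carrier_mat n n" "u \<in> carrier_vec n" "\<theta> u \<in> carrier_vec n"
    using M u by (auto simp: substochastic_def unit_vecs_def theta_carrier)
  have prod_car: "M *\<^sub>v u \<in> carrier_vec n" "M *\<^sub>v \<theta> u \<in> carrier_vec n"
    using car by auto
  have "(M *\<^sub>v \<theta> u) $ i \<ge> 1 \<longleftrightarrow> (M *\<^sub>v u) $ i \<ge> 1" if i: "i < n" for i
  proof
    assume "(M *\<^sub>v \<theta> u) $ i \<ge> 1"
    then have "1 \<le> (\<Sum>j<n. M $$ (i, j) * \<theta> u $ j)"
      using mult_mat_vec_index[OF car(1,3) i] by linarith
    \<comment> \<open>Thresholding never raises a nonnegative entry, and multiplication by the
      nonnegative \<open>M\<close> is monotone.\<close>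
    also have "\<dots> \<le> (\<Sum>j<n. M $$ (i, j) * u $ j)"
      using M u i car
      by (intro sum_mono mult_left_mono) (auto simp: substochastic_def unit_vecs_def theta_index)
    finally show "(M *\<^sub>v u) $ i \<ge> 1"
      using mult_mat_vec_index[OF car(1,2) i] by linarith
  next
    assume ge: "(M *\<^sub>v u) $ i \<ge> 1"
    \<comment> \<open>The deficit, row sum minus entry of \<open>M u\<close>, is a sum of these
      nonnegative terms. It is also at most 0, because the row sum is at most 1 and the entry at
      least 1, so every term vanishes.\<close>
    have nonneg: "0 \<le> M $$ (i, j) * (1 - u $ j)" if "j < n" for j
      using M u i that by (auto simp: substochastic_def unit_vecs_def)
    have "(\<Sum>j<n. M $$ (i, j) * (1 - u $ j)) = (\<Sum>j<n. M $$ (i, j)) - (M *\<^sub>v u) $ i"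
      using mult_mat_vec_index[OF car(1,2) i] by (simp add: right_diff_distrib sum_subtractf)
    also have "\<dots> \<le> 0"
      using M i ge by (auto simp: substochastic_def intro: order_trans)
    finally have "(\<Sum>j<n. M $$ (i, j) * (1 - u $ j)) = 0"
      using nonneg by (intro antisym sum_nonneg) auto
    then have "M $$ (i, j) * (1 - u $ j) = 0" if "j < n" for j
      using nonneg that by (subst (asm) sum_nonneg_eq_0_iff) auto
    \<comment> \<open>Either the weight is 0, or \<open>u $ j\<close> is 1 and survives the
      threshold.\<close>
    then have "M $$ (i, j) * \<theta> u $ j = M $$ (i, j) * u $ j" if "j < n" for j
      using that car by (force simp: theta_index)
    then have "(M *\<^sub>v \<theta> u) $ i = (M *\<^sub>v u) $ i"
      unfolding mult_mat_vec_index[OF car(1,2) i] mult_mat_vec_index[OF car(1,3) i]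
      by (intro sum.cong) auto
    with ge show "(M *\<^sub>v \<theta> u) $ i \<ge> 1" by simp
  qed
  then show ?thesis
    using prod_car[THEN theta_carrier, THEN carrier_vecD]
    by (intro eq_vecI)
      (simp_all add: theta_index[OF prod_car(1)] theta_index[OF prod_car(2)] del: index_mult_mat_vec)
qed

lemma sd_program_body_unique:
  assumes "sd_program P" "Rule h b \<in> P" "Rule h c \<in> P"
  shows "b = c"
  using assms unfolding sd_program_def by (metis rule.inject rule.sel(1))

text \<open>A row belonging to a rule with m > 0 body atoms has at most m nonzero entries, each 1/m.
  Any other row is a unit row (for a fact) or zero.\<close>

lemma substochastic_program_matrix:
  assumes sd: "sd_program P" and inj: "inj_on p {..<n}"
  shows "substochastic n (program_matrix P n p)"
proof -
  let ?M = "program_matrix P n p"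
  have "(\<Sum>j<n. ?M $$ (i, j)) \<le> 1" if i: "i < n" for i
  proof (cases "\<exists>b. Rule (p i) b \<in> P \<and> b \<noteq> []")
    case True
    then obtain b where b: "Rule (p i) b \<in> P" "b \<noteq> []" by blast
    have unique: "c = b" if "Rule (p i) c \<in> P" for c
      using sd_program_body_unique[OF sd that b(1)] .
    have "(THE c. Rule (p i) c \<in> P) = b"
      using b(1) unique by blast
    moreover have "Rule (p i) [] \<notin> P"
      using unique b(2) by blast
    moreover have "(\<exists>c. Rule (p i) c \<in> P \<and> p j \<in> set c) \<longleftrightarrow> p j \<in> set b" for j
      using b(1) unique by blast
    ultimately have "(\<Sum>j<n. ?M $$ (i, j))
        = (\<Sum>j<n. if p j \<in> set b then 1 / real (length b) else 0)"
      using i by (simp add: program_matrix_def cong: if_cong)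
    also have "\<dots> = real (card {j \<in> {..<n}. p j \<in> set b}) / real (length b)"
      by (simp flip: sum.inter_filter)
    also have "\<dots> \<le> 1"
    proof -
      \<comment> \<open>By injectivity of \<open>p\<close>, each body atom accounts for at most one
        column.\<close>
      have "card {j \<in> {..<n}. p j \<in> set b} \<le> card (set b)"
        using inj by (intro card_inj_on_le[where f = p]) (auto intro: inj_on_subset)
      also have "\<dots> \<le> length b" by (rule card_length)
      finally show ?thesis using b(2) by simp
    qed
    finally show ?thesis .
  next
    case False
    then have "?M $$ (i, j) = (if i = j then if Rule (p i) [] \<in> P then 1 else 0 else 0)"
      if "j < n" for j
      using i that by (force simp: program_matrix_def)
    then show ?thesis
      using i by simp
  qed
  then show ?thesis
    by (auto simp: substochastic_def program_matrix_def)
qed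

lemma pow_mat_add:
  fixes M :: "'b::semiring_1 mat"
  assumes "M \<in> carrier_mat n n"
  shows "M ^\<^sub>m (a + b) = M ^\<^sub>m a * M ^\<^sub>m b"
proof (induction b)
  case 0
  show ?case using assms by simp
next
  case (Suc b)
  show ?case
    using assms Suc by (simp add: assoc_mult_mat[of _ n n _ n _ n])
qed

text \<open>Squaring doubles the exponent, and the value chosen at index 0 fits 2^0 = 1, so the
  induction can start there.\<close>

lemma Gamma_eq_pow: "Gamma P n p k = program_matrix P n p ^\<^sub>m (2 ^ k)"
proof (induction k)
  case 0
  show ?case by (simp add: program_matrix_def)
next
  case (Suc k)
  have M: "program_matrix P n p \<in> carrier_mat n n" by (simp add: program_matrix_def)
  with Suc show ?case
    by (simp add: numeral_2_eq_2 flip: pow_mat_add[OF M])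
qed

text \<open>Membership in \<open>unit_vecs\<close> is carried through the induction because
  \<open>theta_mult_theta\<close> needs it to remove the inner threshold at each step.\<close>

lemma v_seq_eq_theta_pow:
  assumes M: "substochastic n (program_matrix P n p)"
  shows "program_matrix P n p ^\<^sub>m m *\<^sub>v initial_vec P n p \<in> unit_vecs n \<and>
    v_seq P n p m = \<theta> (program_matrix P n p ^\<^sub>m m *\<^sub>v initial_vec P n p)"
proof (induction m)
  case 0
  have "program_matrix P n p ^\<^sub>m 0 *\<^sub>v initial_vec P n p = initial_vec P n p"
    by (simp add: program_matrix_def initial_vec_def)
  \<comment> \<open>The initial vector has only entries 0 and 1, so \<open>\<theta>\<close> fixes
    it.\<close>
  then show ?case
    by (auto simp: unit_vecs_def initial_vec_def \<theta>_def)
next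
  case (Suc m)
  have M_car: "program_matrix P n p \<in> carrier_mat n n" and v: "initial_vec P n p \<in> carrier_vec n"
    by (simp_all add: program_matrix_def initial_vec_def)
  \<comment> \<open>The recursion of \<open>^\<^sub>m\<close> adds its factor on the right, whereas
    \<open>v_seq\<close> applies the matrix on the left; splitting the exponent as 1 + m reconciles
    them.\<close>
  have "program_matrix P n p ^\<^sub>m Suc m *\<^sub>v initial_vec P n p
      = program_matrix P n p *\<^sub>v (program_matrix P n p ^\<^sub>m m *\<^sub>v initial_vec P n p)"
    using pow_mat_add[OF M_car, of 1 m] M_car v
    by (simp add: assoc_mult_mat_vec[of _ n n _ n])
  then show ?case
    using Suc substochastic_mult_unit_vecs[OF M] theta_mult_theta[OF M] by simp
qed

theorem theorem4:
  fixes P :: "'a rule set" and n k :: nat and p :: "nat \<Rightarrow> 'a"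
  assumes "sd_program P"
    and "card (herbrand_base P) = n"
    and "bij_betw p {..<n} (herbrand_base P)"
    and "k \<ge> 1"
  shows "\<theta> (Gamma P n p k *\<^sub>v initial_vec P n p) = v_seq P n p (2 ^ k)"
proof -
  have "substochastic n (program_matrix P n p)"
    using assms by (intro substochastic_program_matrix) (auto simp: bij_betw_def)
  then show ?thesis
    by (simp add: Gamma_eq_pow v_seq_eq_theta_pow)
qed

end
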